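(* Let $b$ be a rational number with $b(1+b)\neq 0$ and let $c=0$. Then the cubic polynomials $P(x)$ and $Q(d)$ (defined in the context) are reducible over $\mathbb{Q}$. Moreover, if $b=\frac{t^2-4t+2}{2t}$ for some rational $t\neq 0$, then each of $P$ and $Q$ has three rational roots (counted with multiplicity), these roots can be labelled $x_1,x_2,x_3$ (roots of $P$) and $d_1,d_2,d_3$ (roots of $Q$) so that the auxiliary equations hold, but these six numbers are not all positive, so they do not provide a solution of the perfect cuboid problem (Problem 1.2).
   Context: Let $b,c$ be rational numbers. Put $\Delta=b^2c^4-6b^2c^3+13b^2c^2-12b^2c+4b^2+c^2$ and $N=(bc-1-b)(bc-c-2b)$, and assume $\Delta\,N\neq 0$, so that all the following rational numbers are defined (with $D=b^2c^2+2b^2-3b^2c+c-bc^2+2b$): $E_{11}=-\frac{b(c^2+2-4c)}{D}$, $E_{01}=-\frac{b(c^2+2-2c)}{D}$, $E_{10}=-\frac{b^2c^2+2b^2-3b^2c-c}{D}$; $E_{20}=\frac{b}{2}(bc^2-2c-2b)(2bc^2-c^2-6bc+2+4b)(bc-1-b)^{-2}(bc-c-2b)^{-2}$; $E_{02}=\frac12(28b^2c^2-16b^2c-2c^2-4b^2-b^2c^4+4b^3c^4-12b^3c^3+4bc^3+24b^3c-8bc-2b^4c^4+12b^4c^3-26b^4c^2-8b^2c^3+24b^4c-16b^3-8b^4)(bc-1-b)^{-2}(bc-c-2b)^{-2}$; $E_{21}=\frac{b}{2}(5c^6b-2c^6b^2+52c^5b^2-16c^5b-2c^7b^2+2b^4c^8+142b^4c^6-26b^4c^7-426b^4c^5-61b^3c^6+100b^3c^5+14c^7b^3-c^8b^3-20bc^2-8b^2c^2-16b^2c-128b^2c^4-200b^3c^3+244b^3c^2+32bc^3-112b^3c+768b^4c^4-852b^4c^3+568b^4c^2+104b^2c^3-208b^4c+8c^4-4c^3+16b^3+32b^4-2c^5)\,\Delta^{-1}(bc-1-b)^{-2}(bc-c-2b)^{-2}$;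 $E_{12}=(16b^6+32b^5-6c^5b^2+2c^5b-62b^5c^6+62b^6c^6-180b^6c^5+18b^5c^7-12b^6c^7-2b^5c^8+b^6c^8+248b^5c^2+248b^6c^2-96b^6c+321b^6c^4-180b^5c^3-144b^5c-360b^6c^3+b^4c^8+8b^4c^6-6b^4c^7+18b^4c^5+7b^3c^6+90b^5c^5-14b^3c^5-c^7b^3+17b^2c^4+28b^3c^3-28b^3c^2-4bc^3+8b^3c-57b^4c^4+36b^4c^3+32b^4c^2-12b^2c^3-48b^4c-c^4+16b^4)\,\Delta^{-1}(bc-1-b)^{-2}(bc-c-2b)^{-2}$; $E_{03}=\frac{b}{2}(b^2c^4-5b^2c^3+10b^2c^2-10b^2c+4b^2+2bc+2c^2-bc^3)(2b^2c^4-12b^2c^3+26b^2c^2-24b^2c+8b^2-c^4b+3bc^3-6bc+4b+c^3-2c^2+2c)\,\Delta^{-1}(bc-1-b)^{-2}(bc-c-2b)^{-2}$; $E_{30}=c\,b^2(1-c)(c-2)(bc^2-4bc+2+4b)(2bc^2-c^2-4bc+2b)\,\Delta^{-1}(bc-1-b)^{-2}(bc-c-2b)^{-2}$. Define $P(x)=x^3-E_{10}x^2+E_{20}x-E_{30}$ and $Q(d)=d^3-E_{01}d^2+E_{02}d-E_{03}$. For numbers $x_1,x_2,x_3,d_1,d_2,d_3$ the auxiliary equations are: $x_1x_2d_3+x_2x_3d_1+x_3x_1d_2=E_{21}$, $x_1d_2+d_1x_2+x_2d_3+d_2x_3+x_3d_1+d_3x_1=E_{11}$, $x_1d_2d_3+x_2d_3d_1+x_3d_1d_2=E_{12}$.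 Problem 1.2 (equivalent to finding a perfect cuboid) asks for rational $b,c$ such that $P$ and $Q$ have positive rational roots $x_1,x_2,x_3$ and $d_1,d_2,d_3$ satisfying the auxiliary equations. *)

theory Defs
  imports "HOL-Computational_Algebra.Computational_Algebra"
begin

definition Delta :: "rat \<Rightarrow> rat \<Rightarrow> rat" where
  "Delta b c =
    b^2 * c^4 - 6 * b^2 * c^3 + 13 * b^2 * c^2 - 12 * b^2 * c + 4 * b^2 + c^2"

definition N :: "rat \<Rightarrow> rat \<Rightarrow> rat" where
  "N b c = (b * c - 1 - b) * (b * c - c - 2 * b)"

definition D :: "rat \<Rightarrow> rat \<Rightarrow> rat" where
  "D b c =
    b^2 * c^2 + 2 * b^2 - 3 * b^2 * c + c - b * c^2 + 2 * b"

definition E11 :: "rat \<Rightarrow> rat \<Rightarrow> rat" where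
  "E11 b c =
    - (b * (c^2 + 2 - 4 * c)) / D b c"

definition E01 :: "rat \<Rightarrow> rat \<Rightarrow> rat" where
  "E01 b c =
    - (b * (c^2 + 2 - 2 * c)) / D b c"

definition E10 :: "rat \<Rightarrow> rat \<Rightarrow> rat" where
  "E10 b c =
    - (b^2 * c^2 + 2 * b^2 - 3 * b^2 * c - c) / D b c"

definition E20 :: "rat \<Rightarrow> rat \<Rightarrow> rat" where
  "E20 b c =
    b / 2 * (b * c^2 - 2 * c - 2 * b) * (2 * b * c^2 - c^2 - 6 * b * c + 2
       + 4 * b)
      / ((b * c - 1 - b)^2 * (b * c - c - 2 * b)^2)"

definition E02 :: "rat \<Rightarrow> rat \<Rightarrow> rat" where
  "E02 b c =
    1 / 2 * (28 * b^2 * c^2 - 16 * b^2 * c - 2 * c^2 - 4 * b^2 - b^2 * c^4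
       + 4 * b^3 * c^4 - 12 * b^3 * c^3 + 4 * b * c^3 + 24 * b^3 * c - 8 * b * c
       - 2 * b^4 * c^4 + 12 * b^4 * c^3 - 26 * b^4 * c^2 - 8 * b^2 * c^3 + 24 * b^4 * c
       - 16 * b^3 - 8 * b^4)
      / ((b * c - 1 - b)^2 * (b * c - c - 2 * b)^2)"

definition E21 :: "rat \<Rightarrow> rat \<Rightarrow> rat" where
  "E21 b c =
    b / 2 * (5 * c^6 * b - 2 * c^6 * b^2 + 52 * c^5 * b^2 - 16 * c^5 * b - 2 * c^7 * b^2
       + 2 * b^4 * c^8 + 142 * b^4 * c^6 - 26 * b^4 * c^7 - 426 * b^4 * c^5
       - 61 * b^3 * c^6 + 100 * b^3 * c^5 + 14 * c^7 * b^3 - c^8 * b^3 - 20 * b * c^2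
       - 8 * b^2 * c^2 - 16 * b^2 * c - 128 * b^2 * c^4 - 200 * b^3 * c^3
       + 244 * b^3 * c^2 + 32 * b * c^3 - 112 * b^3 * c + 768 * b^4 * c^4
       - 852 * b^4 * c^3 + 568 * b^4 * c^2 + 104 * b^2 * c^3 - 208 * b^4 * c + 8 * c^4
       - 4 * c^3 + 16 * b^3 + 32 * b^4 - 2 * c^5)
      / (Delta b c * ((b * c - 1 - b)^2 * (b * c - c - 2 * b)^2))"

definition E12 :: "rat \<Rightarrow> rat \<Rightarrow> rat" where
  "E12 b c =
    (16 * b^6 + 32 * b^5 - 6 * c^5 * b^2 + 2 * c^5 * b - 62 * b^5 * c^6 + 62 * b^6 * c^6
       - 180 * b^6 * c^5 + 18 * b^5 * c^7 - 12 * b^6 * c^7 - 2 * b^5 * c^8 + b^6 * c^8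
       + 248 * b^5 * c^2 + 248 * b^6 * c^2 - 96 * b^6 * c + 321 * b^6 * c^4
       - 180 * b^5 * c^3 - 144 * b^5 * c - 360 * b^6 * c^3 + b^4 * c^8 + 8 * b^4 * c^6
       - 6 * b^4 * c^7 + 18 * b^4 * c^5 + 7 * b^3 * c^6 + 90 * b^5 * c^5
       - 14 * b^3 * c^5 - c^7 * b^3 + 17 * b^2 * c^4 + 28 * b^3 * c^3 - 28 * b^3 * c^2
       - 4 * b * c^3 + 8 * b^3 * c - 57 * b^4 * c^4 + 36 * b^4 * c^3 + 32 * b^4 * c^2
       - 12 * b^2 * c^3 - 48 * b^4 * c - c^4 + 16 * b^4)
      / (Delta b c * ((b * c - 1 - b)^2 * (b * c - c - 2 * b)^2))"

definition E03 :: "rat \<Rightarrow> rat \<Rightarrow> rat" where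
  "E03 b c =
    b / 2 * (b^2 * c^4 - 5 * b^2 * c^3 + 10 * b^2 * c^2 - 10 * b^2 * c + 4 * b^2
       + 2 * b * c + 2 * c^2 - b * c^3) * (2 * b^2 * c^4 - 12 * b^2 * c^3
       + 26 * b^2 * c^2 - 24 * b^2 * c + 8 * b^2 - c^4 * b + 3 * b * c^3 - 6 * b * c
       + 4 * b + c^3 - 2 * c^2 + 2 * c)
      / (Delta b c * ((b * c - 1 - b)^2 * (b * c - c - 2 * b)^2))"

definition E30 :: "rat \<Rightarrow> rat \<Rightarrow> rat" where
  "E30 b c =
    c * b^2 * (1 - c) * (c - 2) * (b * c^2 - 4 * b * c + 2 + 4 * b) * (2 * b * c^2 - c^2
       - 4 * b * c + 2 * b)
      / (Delta b c * ((b * c - 1 - b)^2 * (b * c - c - 2 * b)^2))"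

text \<open>Division on \<^typ>\<open>rat\<close> is total, so the coefficients above are only meaningful where
  \<open>Delta b c * N b c \<noteq> 0\<close>. This covers the denominator \<^const>\<open>D\<close> as well, since
  it is \<^const>\<open>N\<close> multiplied out.\<close>

lemma D_eq_N: "D b c = N b c"
  unfolding D_def N_def by (simp add: algebra_simps power2_eq_square)

lemma nondegenerate_at_zero:
  assumes "b * (1 + b) \<noteq> 0"
  shows "Delta b 0 * N b 0 \<noteq> 0"
proof -
  have "Delta b 0 * N b 0 = 8 * b^2 * (b * (1 + b))"
    unfolding Delta_def N_def by (simp add: algebra_simps power2_eq_square)
  then show ?thesis using assms by simp
qed

definition P :: "rat \<Rightarrow> rat \<Rightarrow> rat poly" where
  "P b c = [: - E30 b c, E20 b c, - E10 b c, 1 :]"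

definition Q :: "rat \<Rightarrow> rat \<Rightarrow> rat poly" where
  "Q b c = [: - E03 b c, E02 b c, - E01 b c, 1 :]"

definition auxiliary_equations ::
  "rat \<Rightarrow> rat \<Rightarrow> rat \<Rightarrow> rat \<Rightarrow> rat \<Rightarrow> rat \<Rightarrow> rat \<Rightarrow> rat \<Rightarrow> bool" where
  "auxiliary_equations b c x1 x2 x3 d1 d2 d3 \<longleftrightarrow>
     x1 * x2 * d3 + x2 * x3 * d1 + x3 * x1 * d2 = E21 b c \<and>
     x1 * d2 + d1 * x2 + x2 * d3 + d2 * x3 + x3 * d1 + d3 * x1 = E11 b c \<and>
     x1 * d2 * d3 + x2 * d3 * d1 + x3 * d1 * d2 = E12 b c"

text \<open>The roots are counted with multiplicity: \<^const>\<open>proots\<close> is the multiset of rational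
  roots, so \<open>proots (P b c) = {#x1, x2, x3#}\<close> says that the cubic splits over the
  rationals with exactly these roots.\<close>

definition cuboid_roots ::
  "rat \<Rightarrow> rat \<Rightarrow> rat \<Rightarrow> rat \<Rightarrow> rat \<Rightarrow> rat \<Rightarrow> rat \<Rightarrow> rat \<Rightarrow> bool" where
  "cuboid_roots b c x1 x2 x3 d1 d2 d3 \<longleftrightarrow>
     proots (P b c) = {#x1, x2, x3#} \<and>
     proots (Q b c) = {#d1, d2, d3#} \<and>
     auxiliary_equations b c x1 x2 x3 d1 d2 d3"

text \<open>The perfect cuboid problem: find rational \<open>b\<close> and \<open>c\<close> with the following property.\<close>

definition solves_cuboid_problem :: "rat \<Rightarrow> rat \<Rightarrow> bool" where
  "solves_cuboid_problem b c \<longleftrightarrow>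
     Delta b c * N b c \<noteq> 0 \<and>
     (\<exists>x1 x2 x3 d1 d2 d3. cuboid_roots b c x1 x2 x3 d1 d2 d3 \<and>
        0 < x1 \<and> 0 < x2 \<and> 0 < x3 \<and> 0 < d1 \<and> 0 < d2 \<and> 0 < d3)"

end

theory Submission
  imports Defs
begin

text \<open>At \<open>c = 0\<close> the cubics have the roots \<open>x = 0\<close> and \<open>d = -1\<close>. The remaining quadratic factors
  have opposite roots and discriminant \<open>((b + 2)^2 - 2) / (1 + b)^2\<close>; the curve \<open>(b + 2)^2 - 2 = s^2\<close>
  is rationally parametrised by \<open>b + 2 = (t^2 + 2) / (2 t)\<close>, \<open>s = (t^2 - 2) / (2 t)\<close>, so both cubics split
  for these \<open>b\<close>. The root \<open>x = 0\<close> excludes positivity.\<close>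

text \<open>A root splits off a linear factor, and degree above 1 leaves a cofactor of positive
  degree, so neither factor is a unit.\<close>

lemma not_irreducible_if_root:
  fixes p :: "'a::field poly"
  assumes "poly p a = 0" and "degree p > 1"
  shows "\<not> irreducible p"
proof
  assume irr: "irreducible p"
  obtain q where p: "p = [:- a, 1:] * q"
    using assms(1) by (auto simp: poly_eq_0_iff_dvd)
  have "q \<noteq> 0"
    using p assms(2) by auto
  then have "degree p = Suc (degree q)"
    unfolding p by (subst degree_mult_eq) auto
  then have "\<not> q dvd 1"
    using assms(2) by (auto simp: is_unit_iff_degree \<open>q \<noteq> 0\<close>)
  moreover have "\<not> [:- a, 1:] dvd 1"
    by (simp add: is_unit_iff_degree)
  ultimately show False
    using irreducibleD[OF irr p] by blast
qed

text \<open>Vieta's formulas, with the sign pattern of \<open>P\<close> and \<open>Q\<close>, reduce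
  finding all roots to three identities between symmetric functions.\<close>

lemma proots_monic_cubic:
  fixes x y z :: "'a::idom"
  assumes "e1 = x + y + z" and "e2 = x * y + y * z + z * x" and "e3 = x * y * z"
  shows "proots [:- e3, e2, - e1, 1:] = {#x, y, z#}"
proof -
  have "[:- e3, e2, - e1, 1:] = [:- x, 1:] * ([:- y, 1:] * [:- z, 1:])"
    by (simp add: assms algebra_simps)
  also have "proots \<dots> = proots [:- x, 1:] + (proots [:- y, 1:] + proots [:- z, 1:])"
    by (subst proots_mult, simp, simp, subst proots_mult, simp_all)
  also have "\<dots> = {#x, y, z#}"
    by simp
  finally show ?thesis .
qed

lemma E30_zero [simp]: "E30 b 0 = 0"
  by (simp add: E30_def)

lemma coefficients_zero:
  assumes "b * (1 + b) \<noteq> 0"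
  shows "E10 b 0 = - b / (1 + b)"
    and "E01 b 0 = - 1 / (1 + b)"
    and "E11 b 0 = - 1 / (1 + b)"
    and "E20 b 0 = - (1 + 2 * b) / (2 * (1 + b)^2)"
    and "E02 b 0 = - (1 + 4 * b + 2 * b^2) / (2 * (1 + b)^2)"
    and "E21 b 0 = (1 + 2 * b) / (2 * (1 + b)^2)"
    and "E12 b 0 = 1"
    and "E03 b 0 = (1 + 2 * b) / (2 * (1 + b)^2)"
proof -
  have nz: "b \<noteq> 0" "1 + b \<noteq> 0"
    using assms by auto
  have D: "D b 0 = 2 * b * (1 + b)"
    by (simp add: D_def algebra_simps power2_eq_square)
  have Delta: "Delta b 0 = 4 * b^2"
    by (simp add: Delta_def)
  \<comment> \<open>The zeros stay unevaluated so that the left side matches the unfolded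
    denominators literally.\<close>
  have N2: "(b * 0 - 1 - b)^2 * (b * 0 - 0 - 2 * b)^2 = 4 * b^2 * (1 + b)^2"
    by algebra
  show "E10 b 0 = - b / (1 + b)"
    unfolding E10_def D using nz by (simp add: power2_eq_square)
  show "E01 b 0 = - 1 / (1 + b)"
    unfolding E01_def D using nz by (simp add: frac_eq_eq)
  show "E11 b 0 = - 1 / (1 + b)"
    unfolding E11_def D using nz by (simp add: frac_eq_eq)
  show "E20 b 0 = - (1 + 2 * b) / (2 * (1 + b)^2)"
    unfolding E20_def N2 using nz by (simp add: divide_simps) algebra
  show "E02 b 0 = - (1 + 4 * b + 2 * b^2) / (2 * (1 + b)^2)"
    unfolding E02_def N2 using nz by (simp add: divide_simps) algebra
  show "E21 b 0 = (1 + 2 * b) / (2 * (1 + b)^2)"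
    unfolding E21_def N2 Delta using nz by (simp add: frac_eq_eq) algebra
  show "E12 b 0 = 1"
    unfolding E12_def N2 Delta using nz by (simp add: divide_eq_eq) algebra
  show "E03 b 0 = (1 + 2 * b) / (2 * (1 + b)^2)"
    unfolding E03_def N2 Delta using nz by (simp add: frac_eq_eq) algebra
qed

lemma poly_P_zero: "poly (P b 0) 0 = 0"
  by (simp add: P_def)

lemma poly_Q_zero:
  assumes "b * (1 + b) \<noteq> 0"
  shows "poly (Q b 0) (- 1) = 0"
proof -
  have "1 + b \<noteq> 0"
    using assms by auto
  then show ?thesis
    by (simp add: Q_def coefficients_zero[OF assms] divide_simps) algebra
qed

lemma degree_P [simp]: "degree (P b c) = 3"
  and degree_Q [simp]: "degree (Q b c) = 3"
  by (simp_all add: P_def Q_def)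

text \<open>Here \<open>u\<close> and \<open>v\<close> are the roots of \<open>P b 0\<close> divided
  by \<open>x\<close>. The labelling is crossed: \<open>d2 = - v\<close> sits opposite
  \<open>x2 = u\<close>, and \<open>d3 = - u\<close> opposite \<open>x3 = v\<close>. Thus the second
  and third auxiliary equations contain \<open>u^2 + v^2\<close>; the uncrossed labelling would put
  \<open>2 * u * v\<close> there.\<close>

lemma cuboid_roots_zero:
  assumes "b * (1 + b) \<noteq> 0"
    and sum: "u + v = - b / (1 + b)"
    and prod: "u * v = - (1 + 2 * b) / (2 * (1 + b)^2)"
  shows "cuboid_roots b 0 0 u v (- 1) (- v) (- u)"
proof -
  have nz: "1 + b \<noteq> 0"
    using assms(1) by auto
  \<comment> \<open>Over the denominator \<open>(1 + b)^2\<close> the numerator is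
    \<open>b^2 + (1 + 2 * b)\<close>, a perfect square.\<close>
  have squares: "u^2 + v^2 = 1"
  proof -
    have "u^2 + v^2 = (u + v)^2 - 2 * (u * v)"
      by algebra
    also have "\<dots> = 1"
      unfolding sum prod using nz by (simp add: field_simps) algebra
    finally show ?thesis .
  qed
  have "proots (P b 0) = {#0, u, v#}"
    unfolding P_def by (rule proots_monic_cubic) (simp_all add: coefficients_zero[OF assms(1)] sum prod)
  moreover have "proots (Q b 0) = {#- 1, - v, - u#}"
    unfolding Q_def
  proof (rule proots_monic_cubic)
    have "- 1 + - v + - u = - 1 - (u + v)"
      by simp
    also have "\<dots> = E01 b 0"
      unfolding sum coefficients_zero[OF assms(1)] using nz by (simp add: field_simps)
    finally show "E01 b 0 = - 1 + - v + - u" ..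
    have "- 1 * - v + - v * - u + - u * - 1 = (u + v) + u * v"
      by algebra
    also have "\<dots> = E02 b 0"
      unfolding sum prod coefficients_zero[OF assms(1)] using nz
      by (simp add: divide_simps) algebra
    finally show "E02 b 0 = - 1 * - v + - v * - u + - u * - 1" ..
    have "- 1 * - v * - u = - (u * v)"
      by simp
    also have "\<dots> = E03 b 0"
      unfolding prod coefficients_zero[OF assms(1)] minus_divide_left by simp
    finally show "E03 b 0 = - 1 * - v * - u" ..
  qed
  moreover have "auxiliary_equations b 0 0 u v (- 1) (- v) (- u)"
    unfolding auxiliary_equations_def
  proof (intro conjI)
    have "0 * u * - u + u * v * - 1 + v * 0 * - v = - (u * v)"
      by simp
    also have "\<dots> = E21 b 0"
      unfolding prod coefficients_zero[OF assms(1)] minus_divide_left by simp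
    finally show "0 * u * - u + u * v * - 1 + v * 0 * - v = E21 b 0" .
    have "0 * - v + - 1 * u + u * - u + - v * v + v * - 1 + - u * 0
        = - (u + v) - (u^2 + v^2)"
      by algebra
    also have "\<dots> = E11 b 0"
      unfolding squares sum coefficients_zero[OF assms(1)] using nz by (simp add: field_simps)
    finally show "0 * - v + - 1 * u + u * - u + - v * v + v * - 1 + - u * 0 = E11 b 0" .
    have "0 * - v * - u + u * - u * - 1 + v * - 1 * - v = u^2 + v^2"
      by algebra
    then show "0 * - v * - u + u * - u * - 1 + v * - 1 * - v = E12 b 0"
      unfolding squares coefficients_zero[OF assms(1)] .
  qed
  ultimately show ?thesis
    unfolding cuboid_roots_def by blast
qed

text \<open>The quadratic formula gives \<open>u\<close> and \<open>v\<close> as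
  \<open>(- b + s) / (2 * (1 + b))\<close> and \<open>(- b - s) / (2 * (1 + b))\<close> with
  \<open>s = (t^2 - 2) / (2 * t)\<close>; the denominator \<open>w\<close> is
  \<open>2 * t * (1 + b)\<close>.\<close>

lemma cuboid_roots_zero_parametrised:
  assumes "b * (1 + b) \<noteq> 0" and "t \<noteq> 0" and b: "b = (t^2 - 4 * t + 2) / (2 * t)"
  defines "w \<equiv> t^2 - 2 * t + 2"
  defines "u \<equiv> 2 * (t - 1) / w" and "v \<equiv> t * (2 - t) / w"
  shows "cuboid_roots b 0 0 u v (- 1) (- v) (- u)"
proof (rule cuboid_roots_zero[OF assms(1)])
  have b1: "1 + b = w / (2 * t)"
    unfolding b w_def using \<open>t \<noteq> 0\<close> by (simp add: field_simps)
  then have "w \<noteq> 0"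
    using assms(1) by auto
  have "u + v = - (t^2 - 4 * t + 2) / w"
    unfolding u_def v_def add_divide_distrib[symmetric] by (rule arg_cong[of _ _ "\<lambda>x. x / w"]) algebra
  also have "\<dots> = - b / (1 + b)"
    unfolding b1 unfolding b using \<open>t \<noteq> 0\<close> \<open>w \<noteq> 0\<close> by simp
  finally show "u + v = - b / (1 + b)" .
  \<comment> \<open>The factors \<open>t - 1\<close> and \<open>t - 2\<close> are, up to sign, those
    in the numerators of \<open>u\<close> and \<open>v\<close>.\<close>
  have b2: "1 + 2 * b = (t - 1) * (t - 2) / t"
    unfolding b using \<open>t \<noteq> 0\<close> by (simp add: field_simps power2_eq_square)
  show "u * v = - (1 + 2 * b) / (2 * (1 + b)^2)"
    unfolding b1 b2 u_def v_def using \<open>t \<noteq> 0\<close> \<open>w \<noteq> 0\<close> by (simp add: field_simps) algebra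
qed

text \<open>The multiset of roots of \<open>P b 0\<close> contains 0, so every labelling assigns 0
  to some \<open>x\<close>.\<close>

lemma cuboid_roots_zero_not_positive:
  assumes "cuboid_roots b 0 x1 x2 x3 d1 d2 d3"
  shows "\<not> (0 < x1 \<and> 0 < x2 \<and> 0 < x3)"
proof -
  \<comment> \<open>Roots are members of \<open>proots\<close> only for a nonzero polynomial, since
    \<open>proots 0\<close> is empty.\<close>
  have "P b 0 \<noteq> 0"
    by (simp add: P_def)
  then have "0 \<in># proots (P b 0)"
    using poly_P_zero by simp
  then have "0 \<in># {#x1, x2, x3#}"
    using assms unfolding cuboid_roots_def by simp
  then show ?thesis
    by auto
qed

theorem theorem3p1:
  fixes b c :: rat
  assumes "b * (1 + b) \<noteq> 0" and "c = 0"
  shows "\<not> irreducible (P b c) \<and> \<not> irreducible (Q b c) \<and>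
    (\<forall>t::rat. t \<noteq> 0 \<and> b = (t^2 - 4 * t + 2) / (2 * t) \<longrightarrow>
      (\<exists>x1 x2 x3 d1 d2 d3. cuboid_roots b c x1 x2 x3 d1 d2 d3) \<and>
      (\<forall>x1 x2 x3 d1 d2 d3. cuboid_roots b c x1 x2 x3 d1 d2 d3 \<longrightarrow>
        \<not> (0 < x1 \<and> 0 < x2 \<and> 0 < x3 \<and> 0 < d1 \<and> 0 < d2 \<and> 0 < d3)) \<and>
      \<not> solves_cuboid_problem b c)"
proof -
  have "\<not> irreducible (P b 0)"
    by (rule not_irreducible_if_root[OF poly_P_zero]) simp
  moreover have "\<not> irreducible (Q b 0)"
    by (rule not_irreducible_if_root[OF poly_Q_zero[OF assms(1)]]) simp
  moreover have "\<not> solves_cuboid_problem b 0"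
    unfolding solves_cuboid_problem_def using cuboid_roots_zero_not_positive by blast
  ultimately show ?thesis
    unfolding assms(2)
    using cuboid_roots_zero_parametrised[OF assms(1)] cuboid_roots_zero_not_positive by blast
qed

end
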